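(* Let $s,t$ be real numbers with $s\neq0$, $t\neq0$. For all integers $n\geq0$, \[ \genfrac{\{}{\}}{0pt}{}{n+3}{3}_{s,t}=st\genfrac{\{}{\}}{0pt}{}{n+2}{3}_{s,t}+\{n+1\}_{s,t}\genfrac{\{}{\}}{0pt}{}{n+2}{2}_{s,t}. \]
   Context: The generalized Fibonacci polynomials $\{n\}_{s,t}$ are defined by $\{0\}_{s,t}=0$, $\{1\}_{s,t}=1$, $\{n+2\}_{s,t}=s\{n+1\}_{s,t}+t\{n\}_{s,t}$. The generalized factorial is $\{m\}_{s,t}!=\{1\}_{s,t}\cdots\{m\}_{s,t}$. For integers $m\geq 0$ with $m-d+1\geq 0$, $\genfrac{\{}{\}}{0pt}{}{m}{d}_{s,t}=\frac{\{m-d+1\}_{s,t}\{m-d+2\}_{s,t}\cdots\{m\}_{s,t}}{\{d\}_{s,t}!}$; in particular $\genfrac{\{}{\}}{0pt}{}{m}{2}_{s,t}=\frac{\{m-1\}_{s,t}\{m\}_{s,t}}{\{2\}_{s,t}!}$ and $\genfrac{\{}{\}}{0pt}{}{m}{3}_{s,t}=\frac{\{m-2\}_{s,t}\{m-1\}_{s,t}\{m\}_{s,t}}{\{3\}_{s,t}!}$ (generalized triangular and tetrahedral numbers). Denominators are assumed nonzero. *)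

theory Defs
  imports Complex_Main
begin

fun gfib :: "real \<Rightarrow> real \<Rightarrow> nat \<Rightarrow> real" where
  "gfib s t 0 = 0"
| "gfib s t (Suc 0) = 1"
| "gfib s t (Suc (Suc n)) = s * gfib s t (Suc n) + t * gfib s t n"

definition gfib_fact :: "real \<Rightarrow> real \<Rightarrow> nat \<Rightarrow> real" where
  "gfib_fact s t m = (\<Prod>k=1..m. gfib s t k)"

text \<open>Intended for \<open>d \<le> m + 1\<close>. The lower bound is written \<open>m + 1 - d\<close> rather than
  \<open>m - d + 1\<close> so that the truncated subtraction is exact in the boundary case \<open>m = d - 1\<close>,
  where the product runs over \<open>0, \<dots>, m\<close>.\<close>

definition gfib_binom :: "real \<Rightarrow> real \<Rightarrow> nat \<Rightarrow> nat \<Rightarrow> real" where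
  "gfib_binom s t m d = (\<Prod>k=m + 1 - d..m. gfib s t k) / gfib_fact s t d"

end

theory Submission
  imports Defs
begin

text \<open>Applying the recurrence twice gives {n+3} = {3}{n+1} + st{n}, where {3} = s^2 + t.
  Multiplying by {n+1}{n+2} / {3}! splits the left side in two: the st{n} part is st times the
  tetrahedral number at n+2, and in the other part {3} cancels against {3}! = {2}!{3}, leaving {n+1}
  times the triangular number at n+2.\<close>

theorem theorem5:
  fixes s t :: real and n :: nat
  assumes "s \<noteq> 0" and "t \<noteq> 0"
    and "gfib_fact s t 2 \<noteq> 0" and "gfib_fact s t 3 \<noteq> 0"
  shows "gfib_binom s t (n + 3) 3 =
    s * t * gfib_binom s t (n + 2) 3 + gfib s t (n + 1) * gfib_binom s t (n + 2) 2"
proof -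
  define a b c where "a = gfib s t n" and "b = gfib s t (Suc n)" and "c = gfib s t (Suc (Suc n))"
  have fact2: "gfib_fact s t 2 = s"
    by (simp add: gfib_fact_def numeral_eq_Suc)
  have fact3: "gfib_fact s t 3 = s * (s\<^sup>2 + t)"
    by (simp add: gfib_fact_def numeral_eq_Suc algebra_simps)
  have nz: "s\<^sup>2 + t \<noteq> 0"
    using assms(4) fact3 by auto
  \<comment> \<open>The coefficient of \<open>b\<close> is {3}, the very factor by which {3}!
    exceeds {2}!.\<close>
  have step: "gfib s t (Suc (Suc (Suc n))) = (s\<^sup>2 + t) * b + s * t * a"
    by (simp add: a_def b_def power2_eq_square algebra_simps)
  have prod2: "(\<Prod>k=m..Suc m. gfib s t k) = gfib s t m * gfib s t (Suc m)" for m
    by simp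
  have prod3: "(\<Prod>k=m..Suc (Suc m). gfib s t k)
      = gfib s t m * gfib s t (Suc m) * gfib s t (Suc (Suc m))" for m
    by (simp del: gfib.simps)
  \<comment> \<open>The truncated subtractions are exact even for n = 0, where the product for
    \<open>gfib_binom s t (n + 2) 3\<close> starts at index 0 and so vanishes.\<close>
  have idx: "n + 3 = Suc (Suc (Suc n))" "n + 2 = Suc (Suc n)" "Suc (Suc (Suc n)) + 1 - 3 = Suc n"
    "Suc (Suc n) + 1 - 3 = n" "Suc (Suc n) + 1 - 2 = Suc n"
    by simp_all
  have "gfib_binom s t (n + 3) 3 = b * c * ((s\<^sup>2 + t) * b + s * t * a) / (s * (s\<^sup>2 + t))"
    unfolding gfib_binom_def idx prod3 fact3 step b_def c_def ..
  moreover have "gfib_binom s t (n + 2) 3 = a * b * c / (s * (s\<^sup>2 + t))"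
    unfolding gfib_binom_def idx prod3 fact3 a_def b_def c_def ..
  moreover have "gfib_binom s t (n + 2) 2 = b * c / s"
    unfolding gfib_binom_def idx prod2 fact2 b_def c_def ..
  moreover have "gfib s t (n + 1) = b"
    by (simp add: b_def)
  \<comment> \<open>With \<open>q\<close> in place of s^2 + t, the denominator is an atom that
    \<open>field_simps\<close> can cancel without expanding it. The recurrence is already spent in
    \<open>step\<close>, so \<open>a\<close>, \<open>b\<close>, \<open>c\<close> may be treated as
    independent.\<close>
  moreover have "b * c * (q * b + s * t * a) / (s * q) = s * t * (a * b * c / (s * q)) + b * (b * c / s)"
    if "q \<noteq> 0" for q
    using assms(1) that by (simp add: field_simps)
  ultimately show ?thesis
    using nz by simp
qed

end
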